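(* Let $\mathbb{F}$ be a field, let $\mathbb{Z}_{\ge0}\Pi$ be the abelian semigroup freely generated by $\Pi=\{\alpha_i\mid i\in\mathcal{I}\}$ ($\mathcal{I}$ an arbitrary, possibly infinite, indexing set), and let $\mathcal{G}$ be a $\mathbb{Z}_{\ge0}\Pi$-graded $\mathbb{F}$-Lie algebra generated by its non-zero subspaces $\mathcal{G}_{\alpha_i}$, $i\in\mathcal{I}$. Suppose $\emptyset\neq I\subset\mathcal{I}$ and $\beta\in\mathcal{A}$ with $\mathrm{ht}_I(\beta)>0$, and let $n=\mathrm{ht}_I(\beta)$. Then $\mathcal{G}_\beta$ is spanned by the Lie words of the form $$\Big[x_{\gamma_1},\big[\cdots,[x_{\gamma_{n-1}},x_{\gamma_n}]\cdots\big]\Big]$$ such that $\gamma_j\in\mathcal{A}_{I,1}$ and $0\neq x_{\gamma_j}\in\mathcal{G}_{\gamma_j}$ for each $1\le j\le n$, and $\sum_{j=1}^n\gamma_j=\beta$.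
   Context: $\mathcal{G}=\bigoplus_{\gamma\in\mathbb{Z}_{\ge0}\Pi}\mathcal{G}_\gamma$ with $[\mathcal{G}_\alpha,\mathcal{G}_\beta]\subset\mathcal{G}_{\alpha+\beta}$; no finite-dimensionality of the graded pieces is assumed. $\mathcal{A}=\{\alpha\in\mathbb{Z}_{\ge0}\Pi\mid\mathcal{G}_\alpha\neq\{0\}\}$. For $\emptyset\ne I\subset\mathcal{I}$ and $x=\sum_ic_i\alpha_i$, $\mathrm{ht}_I(x)=\sum_{i\in I}c_i$, and $\mathcal{A}_{I,1}=\{\gamma\in\mathcal{A}\mid\mathrm{ht}_I(\gamma)=1\}$. For $n=1$ the Lie word is just $x_{\gamma_1}$. *)

theory Defs
  imports Complex_Main "HOL-Library.Poly_Mapping"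
begin

locale lie_algebra = vector_space scale
  for scale :: "'f::field \<Rightarrow> 'v::ab_group_add \<Rightarrow> 'v" +
  fixes bracket :: "'v \<Rightarrow> 'v \<Rightarrow> 'v"
  assumes linear_bracket_right: "Vector_Spaces.linear scale scale (\<lambda>y. bracket x y)"
    and linear_bracket_left: "Vector_Spaces.linear scale scale (\<lambda>x. bracket x y)"
    and bracket_self: "bracket x x = 0"
    and jacobi: "bracket x (bracket y z) + bracket y (bracket z x) + bracket z (bracket x y) = 0"
begin

definition lie_subalgebra :: "'v set \<Rightarrow> bool"
  where "lie_subalgebra S \<longleftrightarrow> subspace S \<and> (\<forall>x\<in>S. \<forall>y\<in>S. bracket x y \<in> S)"

definition lie_generated :: "'v set \<Rightarrow> 'v set"
  where "lie_generated X = lie_subalgebra hull X"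

end

text \<open>The free abelian semigroup (with 0) on \<open>\<Pi> = {\<alpha>\<^sub>i | i}\<close> is the type
  \<open>'i \<Rightarrow>\<^sub>0 nat\<close> of finitely supported functions; the type \<open>'i\<close> is the indexing set.\<close>

definition simple_root :: "'i \<Rightarrow> ('i \<Rightarrow>\<^sub>0 nat)"
  where "simple_root i = Poly_Mapping.single i 1"

definition ht :: "'i set \<Rightarrow> ('i \<Rightarrow>\<^sub>0 nat) \<Rightarrow> nat"
  where "ht I x = (\<Sum>i \<in> I \<inter> Poly_Mapping.keys x. Poly_Mapping.lookup x i)"

text \<open>The axiom \<open>direct_sum\<close> says that the whole algebra is the internal direct sum of the
  subspaces \<open>G \<gamma>\<close>: every vector has exactly one finitely supported family of components.\<close>

locale graded_lie_algebra = lie_algebra scale bracket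
  for scale :: "'f::field \<Rightarrow> 'v::ab_group_add \<Rightarrow> 'v" and bracket :: "'v \<Rightarrow> 'v \<Rightarrow> 'v" +
  fixes G :: "('i \<Rightarrow>\<^sub>0 nat) \<Rightarrow> 'v set"
  assumes subspace_G: "subspace (G \<gamma>)"
    and direct_sum: "\<exists>!f. finite {\<gamma>. f \<gamma> \<noteq> 0} \<and> (\<forall>\<gamma>. f \<gamma> \<in> G \<gamma>) \<and> v = (\<Sum>\<gamma> | f \<gamma> \<noteq> 0. f \<gamma>)"
    and bracket_G: "x \<in> G \<gamma> \<Longrightarrow> y \<in> G \<delta> \<Longrightarrow> bracket x y \<in> G (\<gamma> + \<delta>)"

definition degrees :: "(('i \<Rightarrow>\<^sub>0 nat) \<Rightarrow> 'v::zero set) \<Rightarrow> ('i \<Rightarrow>\<^sub>0 nat) set"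
  where "degrees G = {\<gamma>. G \<gamma> \<noteq> {0}}"

definition degrees1 :: "(('i \<Rightarrow>\<^sub>0 nat) \<Rightarrow> 'v::zero set) \<Rightarrow> 'i set \<Rightarrow> ('i \<Rightarrow>\<^sub>0 nat) set"
  where "degrees1 G I = {\<gamma> \<in> degrees G. ht I \<gamma> = 1}"

text \<open>Right-normed Lie words; the value on the empty list is a dummy.\<close>

fun lie_word :: "('v::zero \<Rightarrow> 'v \<Rightarrow> 'v) \<Rightarrow> 'v list \<Rightarrow> 'v"
  where
    "lie_word br [] = 0"
  | "lie_word br [x] = x"
  | "lie_word br (x # y # zs) = br x (lie_word br (y # zs))"

end

theory Submission
  imports Defs
begin

text \<open>Let \<open>L\<close> be the span of all homogeneous elements of \<open>I\<close>-height 0 together with all right-normed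
  words in homogeneous letters of \<open>I\<close>-height 1. Bracketing with a homogeneous element of height 1
  turns height 0 into a one-letter word and prolongs words; bracketing with one of height 0 acts on
  words as a derivation, preserving the height of the letters. So \<open>L\<close> is stable under the generators.
  The elements stabilising \<open>L\<close> form a subalgebra, hence \<open>L\<close> is an ideal containing the generators and
  thus everything. As \<open>L\<close> is spanned by homogeneous elements, one may take components of degree \<open>\<beta>\<close>,
  where only words survive, and their length is forced by the additivity of the height.\<close>

section \<open>Bilinear calculus and Lie subalgebras\<close>

context lie_algebra
begin

lemma module_hom_bracket_right: "module_hom scale scale (bracket x)"
  using linear_bracket_right[of x] by (simp add: linear_iff_module_hom)

lemma module_hom_bracket_left: "module_hom scale scale (\<lambda>x. bracket x y)"
  using linear_bracket_left[of y] by (simp add: linear_iff_module_hom)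

lemma bracket_add_right: "bracket x (y + z) = bracket x y + bracket x z"
  by (rule module_hom.add[OF module_hom_bracket_right])

lemma bracket_add_left: "bracket (x + y) z = bracket x z + bracket y z"
  by (rule module_hom.add[OF module_hom_bracket_left])

lemma bracket_scale_left: "bracket (scale c x) z = scale c (bracket x z)"
  by (rule module_hom.scale[OF module_hom_bracket_left])

lemma bracket_zero_right [simp]: "bracket x 0 = 0"
  using bracket_add_right[of x 0 0] by simp

lemma bracket_zero_left [simp]: "bracket 0 x = 0"
  using bracket_add_left[of 0 0 x] by simp

lemma bracket_minus_right: "bracket x (- y) = - bracket x y"
  using bracket_add_right[of x y "- y"] by (simp add: add_eq_0_iff)

lemma bracket_antisym: "bracket x y = - bracket y x"
proof -
  have "bracket x y + bracket y x = bracket (x + y) (x + y)"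
    unfolding bracket_add_right bracket_add_left by (simp add: bracket_self)
  then show ?thesis
    by (simp add: bracket_self eq_neg_iff_add_eq_0)
qed

text \<open>Jacobi in the form that \<open>bracket x\<close> is a derivation; antisymmetry brings
  the cyclic sum into this shape.\<close>

lemma bracket_derivation:
  "bracket x (bracket y z) = bracket (bracket x y) z + bracket y (bracket x z)"
  using jacobi[of x y z] bracket_antisym[of z "bracket x y"] bracket_antisym[of z x]
  by (simp add: bracket_minus_right algebra_simps)

lemma bracket_span:
  assumes "subspace V" and "\<And>b. b \<in> B \<Longrightarrow> bracket x b \<in> V" and "y \<in> span B"
  shows "bracket x y \<in> V"
proof -
  have "bracket x ` span B = span (bracket x ` B)"
    by (rule module_hom.span_image[OF module_hom_bracket_right, symmetric])
  also have "\<dots> \<subseteq> V"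
    using assms by (intro span_minimal) auto
  finally show ?thesis using assms(3) by blast
qed

text \<open>By the derivation rule, bracketing with \<open>bracket x y\<close> is the commutator of
  bracketing with \<open>x\<close> and with \<open>y\<close>, and a commutator of maps preserving
  \<open>V\<close> preserves \<open>V\<close>.\<close>

lemma subspace_stabilizer:
  assumes "subspace V"
  shows "lie_subalgebra {y. \<forall>v\<in>V. bracket y v \<in> V}"
proof -
  have "bracket (bracket x y) v \<in> V"
    if "\<forall>v\<in>V. bracket x v \<in> V" "\<forall>v\<in>V. bracket y v \<in> V" "v \<in> V" for x y v
  proof -
    have "bracket (bracket x y) v = bracket x (bracket y v) - bracket y (bracket x v)"
      using bracket_derivation[of x y v] by simp
    then show ?thesis using that assms by (simp add: subspace_diff)
  qed
  then show ?thesis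
    using assms unfolding lie_subalgebra_def
    by (auto simp: subspace_def bracket_add_left bracket_scale_left)
qed

lemma lie_generated_le:
  assumes "lie_subalgebra S" and "X \<subseteq> S"
  shows "lie_generated X \<subseteq> S"
  using assms unfolding lie_generated_def by (simp add: hull_minimal)

text \<open>The stabiliser of \<open>V\<close> is a subalgebra containing \<open>X\<close>, hence
  everything. So \<open>V\<close> is an ideal, in particular a subalgebra containing
  \<open>X\<close>, hence everything too.\<close>

lemma stable_subspace_eq_UNIV:
  assumes gen: "lie_generated X = UNIV" and V: "subspace V" "X \<subseteq> V"
    and stable: "\<And>x v. x \<in> X \<Longrightarrow> v \<in> V \<Longrightarrow> bracket x v \<in> V"
  shows "V = UNIV"
proof -
  have "X \<subseteq> {y. \<forall>v\<in>V. bracket y v \<in> V}"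
    using stable by blast
  then have "{y. \<forall>v\<in>V. bracket y v \<in> V} = UNIV"
    using lie_generated_le[OF subspace_stabilizer[OF V(1)]] gen by blast
  then have "lie_subalgebra V"
    using V unfolding lie_subalgebra_def by blast
  then show ?thesis
    using lie_generated_le[OF _ V(2)] gen by blast
qed

lemma lie_word_Cons: "xs \<noteq> [] \<Longrightarrow> lie_word bracket (x # xs) = bracket x (lie_word bracket xs)"
  by (cases xs) simp_all

text \<open>Lets words with a zero letter be discarded where letters have to be non-zero.\<close>

lemma lie_word_zero_letter: "0 \<in> set xs \<Longrightarrow> lie_word bracket xs = 0"
proof (induction xs)
  case (Cons x xs)
  then show ?case by (cases "xs = []") (auto simp: lie_word_Cons)
qed simp

end

section \<open>Additivity of the height\<close>

lemma ht_eq_sum: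
  assumes "finite F" and "Poly_Mapping.keys x \<subseteq> F"
  shows "ht I x = (\<Sum>i \<in> I \<inter> F. Poly_Mapping.lookup x i)"
  unfolding ht_def using assms
  by (intro sum.mono_neutral_left) (auto simp: in_keys_iff)

lemma ht_add: "ht I (x + y) = ht I x + ht I y"
proof -
  \<comment> \<open>All three heights become sums over this one finite set and can be compared
    termwise.\<close>
  let ?F = "Poly_Mapping.keys x \<union> Poly_Mapping.keys y"
  have "Poly_Mapping.keys (x + y) \<subseteq> ?F"
    by (rule Poly_Mapping.keys_add)
  then show ?thesis
    by (simp add: ht_eq_sum[of ?F] lookup_add sum.distrib)
qed

lemma ht_zero [simp]: "ht I 0 = 0"
  by (simp add: ht_def)

lemma ht_simple_root: "ht I (simple_root i) = (if i \<in> I then 1 else 0)"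
  by (simp add: ht_def simple_root_def)

section \<open>Homogeneous components of a span\<close>

context graded_lie_algebra
begin

text \<open>Vectors in the big span decompose with each \<open>\<gamma>\<close>-component in
  \<open>span (T \<gamma>)\<close>. For \<open>v\<close> in \<open>G \<beta>\<close>, uniqueness
  identifies this decomposition with the one concentrated in \<open>\<beta>\<close>.\<close>

lemma homogeneous_span:
  assumes TG: "\<And>\<gamma>. T \<gamma> \<subseteq> G \<gamma>" and v: "v \<in> span (\<Union>\<gamma>. T \<gamma>)" "v \<in> G \<beta>"
  shows "v \<in> span (T \<beta>)"
proof -
  have span_T: "span (T \<gamma>) \<subseteq> G \<gamma>" for \<gamma>
    by (rule span_minimal[OF TG subspace_G])
  define dec where "dec f w \<longleftrightarrow> finite {\<gamma>. f \<gamma> \<noteq> 0} \<and> (\<forall>\<gamma>. f \<gamma> \<in> span (T \<gamma>)) \<and>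
    w = (\<Sum>\<gamma> | f \<gamma> \<noteq> 0. f \<gamma>)" for f :: "('i \<Rightarrow>\<^sub>0 nat) \<Rightarrow> 'v" and w
  have dec_scale: "dec (\<lambda>\<gamma>. scale c (f \<gamma>)) (scale c w)" if "dec f w" for f w c
  proof -
    have "scale c w = (\<Sum>\<gamma> | f \<gamma> \<noteq> 0. scale c (f \<gamma>))"
      using that by (simp add: dec_def scale_sum_right)
    \<comment> \<open>The support collapses when \<open>c = 0\<close>.\<close>
    also have "\<dots> = (\<Sum>\<gamma> | scale c (f \<gamma>) \<noteq> 0. scale c (f \<gamma>))"
      using that by (intro sum.mono_neutral_right) (auto simp: dec_def)
    finally show ?thesis
      using that by (auto simp: dec_def span_scale elim: rev_finite_subset)
  qed
  have dec_add: "dec (\<lambda>\<gamma>. f \<gamma> + g \<gamma>) (w + u)" if "dec f w" "dec g u" for f g w u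
  proof -
    let ?F = "{\<gamma>. f \<gamma> \<noteq> 0} \<union> {\<gamma>. g \<gamma> \<noteq> 0}"
    have fin: "finite ?F" using that by (simp add: dec_def)
    have "w = sum f ?F" "u = sum g ?F"
      using that fin by (auto simp: dec_def intro!: sum.mono_neutral_left)
    then have "w + u = (\<Sum>\<gamma>\<in>?F. f \<gamma> + g \<gamma>)"
      by (simp add: sum.distrib)
    \<comment> \<open>Components of \<open>f\<close> and \<open>g\<close> may cancel, so the new
      support can be smaller than \<open>?F\<close>.\<close>
    also have "\<dots> = (\<Sum>\<gamma> | f \<gamma> + g \<gamma> \<noteq> 0. f \<gamma> + g \<gamma>)"
      using fin by (intro sum.mono_neutral_right) auto
    finally have "w + u = (\<Sum>\<gamma> | f \<gamma> + g \<gamma> \<noteq> 0. f \<gamma> + g \<gamma>)" .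
    moreover have "finite {\<gamma>. f \<gamma> + g \<gamma> \<noteq> 0}"
      using fin by (rule rev_finite_subset) auto
    ultimately show ?thesis
      using that by (simp add: dec_def span_add)
  qed
  have dec_single: "dec (\<lambda>\<gamma>. if \<gamma> = \<delta> then w else 0) w" if "w \<in> span (T \<delta>)" for \<delta> w
    using that by (cases "w = 0") (auto simp: dec_def span_zero)
  have "subspace {w. \<exists>f. dec f w}"
    unfolding subspace_def
    by (auto intro: dec_single[OF span_zero] dest: dec_add dec_scale)
  moreover have "(\<Union>\<gamma>. T \<gamma>) \<subseteq> {w. \<exists>f. dec f w}"
    by (blast intro: dec_single span_base)
  ultimately obtain f where f: "dec f v"
    using v(1) span_minimal by blast
  let ?g = "\<lambda>\<gamma>. if \<gamma> = \<beta> then v else 0"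
  \<comment> \<open>The predicate of \<open>direct_sum\<close> for this \<open>v\<close>, to which
    uniqueness is applied with \<open>f\<close> and \<open>?g\<close>.\<close>
  define D where "D f \<longleftrightarrow> finite {\<gamma>. f \<gamma> \<noteq> 0} \<and> (\<forall>\<gamma>. f \<gamma> \<in> G \<gamma>) \<and> v = (\<Sum>\<gamma> | f \<gamma> \<noteq> 0. f \<gamma>)"
    for f :: "('i \<Rightarrow>\<^sub>0 nat) \<Rightarrow> 'v"
  have "\<exists>!f. D f"
    unfolding D_def by (rule direct_sum)
  moreover have "D ?g"
    using v(2) subspace_0[OF subspace_G] unfolding D_def by (cases "v = 0") auto
  moreover have "D f"
    using f span_T unfolding dec_def D_def by blast
  ultimately have "f = ?g"
    by blast
  then show ?thesis
    using f unfolding dec_def by (simp split: if_splits)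
qed

section \<open>Words in letters of height 1 and their span\<close>

definition letters :: "'i set \<Rightarrow> 'v list \<Rightarrow> ('i \<Rightarrow>\<^sub>0 nat) list \<Rightarrow> bool"
  where "letters I = list_all2 (\<lambda>x \<gamma>. x \<in> G \<gamma> \<and> ht I \<gamma> = 1)"

definition root_words :: "'i set \<Rightarrow> ('i \<Rightarrow>\<^sub>0 nat) \<Rightarrow> 'v set"
  where "root_words I \<delta> =
    {lie_word bracket xs | xs \<gamma>s. xs \<noteq> [] \<and> letters I xs \<gamma>s \<and> sum_list \<gamma>s = \<delta>}"

lemma root_words_single: "x \<in> G \<gamma> \<Longrightarrow> ht I \<gamma> = 1 \<Longrightarrow> x \<in> root_words I \<gamma>"
  unfolding root_words_def letters_def
  by (intro CollectI exI[of _ "[x]"] exI[of _ "[\<gamma>]"]) simp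

lemma root_words_bracket:
  assumes "x \<in> G \<gamma>" "ht I \<gamma> = 1" "w \<in> root_words I \<delta>"
  shows "bracket x w \<in> root_words I (\<gamma> + \<delta>)"
proof -
  obtain xs \<gamma>s where "w = lie_word bracket xs" "xs \<noteq> []" "letters I xs \<gamma>s" "sum_list \<gamma>s = \<delta>"
    using assms(3) unfolding root_words_def by blast
  then show ?thesis
    using assms(1,2) unfolding root_words_def letters_def
    by (intro CollectI exI[of _ "x # xs"] exI[of _ "\<gamma> # \<gamma>s"]) (simp add: lie_word_Cons)
qed

text \<open>The degree is an argument of \<open>P\<close> because it changes as letters are put in
  front.\<close>

lemma root_words_induct [consumes 1, case_names single bracket]:
  assumes "w \<in> root_words I \<delta>"
    and "\<And>x \<gamma>. x \<in> G \<gamma> \<Longrightarrow> ht I \<gamma> = 1 \<Longrightarrow> P x \<gamma>"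
    and "\<And>x \<gamma> w \<delta>. x \<in> G \<gamma> \<Longrightarrow> ht I \<gamma> = 1 \<Longrightarrow> w \<in> root_words I \<delta> \<Longrightarrow> P w \<delta> \<Longrightarrow>
      P (bracket x w) (\<gamma> + \<delta>)"
  shows "P w \<delta>"
proof -
  have "P (lie_word bracket xs) (sum_list \<gamma>s)" if "letters I xs \<gamma>s" "xs \<noteq> []" for xs \<gamma>s
    using that unfolding letters_def
  proof (induction rule: list_all2_induct)
    case (Cons x xs \<gamma> \<gamma>s)
    show ?case
    proof (cases "xs = []")
      case True
      then show ?thesis using Cons assms(2) by simp
    next
      case False
      then have "lie_word bracket xs \<in> root_words I (sum_list \<gamma>s)"
        using Cons.hyps unfolding root_words_def letters_def by blast
      then show ?thesis
        using Cons False assms(3) by (simp add: lie_word_Cons)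
    qed
  qed simp
  then show ?thesis
    using assms(1) unfolding root_words_def by blast
qed

lemma root_words_subset: "root_words I \<delta> \<subseteq> G \<delta>"
proof
  fix w assume "w \<in> root_words I \<delta>"
  then show "w \<in> G \<delta>"
    by (induction rule: root_words_induct) (auto intro: bracket_G)
qed

text \<open>The derivation rule moves \<open>y\<close> onto each letter in turn. The letter's degree
  changes by \<open>\<epsilon>\<close>, so its height stays 1 and each summand is again a
  word.\<close>

lemma bracket_height0_root_word:
  assumes y: "y \<in> G \<epsilon>" "ht I \<epsilon> = 0" and "w \<in> root_words I \<delta>"
  shows "bracket y w \<in> span (root_words I (\<epsilon> + \<delta>))"
  using assms(3)
proof (induction rule: root_words_induct)
  case (single x \<gamma>)
  then show ?case
    using y by (intro span_base root_words_single bracket_G) (simp_all add: ht_add)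
next
  case (bracket x \<gamma> w \<delta>)
  have "bracket (bracket y x) w \<in> root_words I (\<epsilon> + \<gamma> + \<delta>)"
    using y bracket by (intro root_words_bracket bracket_G) (simp_all add: ht_add)
  \<comment> \<open>The induction hypothesis only places \<open>bracket y w\<close> in a span, so
    \<open>x\<close> is prepended to the spanning words.\<close>
  moreover have "bracket x (bracket y w) \<in> span (root_words I (\<gamma> + (\<epsilon> + \<delta>)))"
    using bracket.IH by (rule bracket_span[OF subspace_span, rotated])
      (intro span_base root_words_bracket bracket.hyps)
  ultimately show ?case
    unfolding bracket_derivation[of y x w] by (simp add: ac_simps span_add span_base)
qed

text \<open>\<open>T\<close> sorts the spanning set by degree, the form that
  \<open>homogeneous_span\<close> takes. Its span is stable because the generators have height at
  most 1.\<close>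

lemma span_height0_root_words:
  fixes I
  defines "T \<equiv> \<lambda>\<delta>. root_words I \<delta> \<union> (if ht I \<delta> = 0 then G \<delta> else {})"
  assumes gen: "lie_generated (\<Union>i. G (simple_root i)) = UNIV"
  shows "span (\<Union>\<delta>. T \<delta>) = UNIV"
proof (rule stable_subspace_eq_UNIV[OF gen subspace_span])
  \<comment> \<open>Covers both the generators and their brackets with elements of height 0.\<close>
  have T_low: "G \<gamma> \<subseteq> T \<gamma>" if "ht I \<gamma> \<le> 1" for \<gamma>
    using that root_words_single[of _ \<gamma> I] by (auto simp: T_def le_Suc_eq)
  have ht_root: "ht I (simple_root i) \<le> 1" for i
    by (simp add: ht_simple_root)
  show "(\<Union>i. G (simple_root i)) \<subseteq> span (\<Union>\<delta>. T \<delta>)"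
    using T_low[OF ht_root] span_superset[of "\<Union>\<delta>. T \<delta>"] by blast
  fix x v assume "x \<in> (\<Union>i. G (simple_root i))" and v: "v \<in> span (\<Union>\<delta>. T \<delta>)"
  then obtain \<gamma> where x: "x \<in> G \<gamma>" "ht I \<gamma> \<le> 1" using ht_root by blast
  have stable: "bracket x b \<in> span (T (\<gamma> + \<delta>))" if "b \<in> T \<delta>" for b \<delta>
  proof (cases "b \<in> root_words I \<delta>")
    case True
    have "bracket x b \<in> span (root_words I (\<gamma> + \<delta>))"
    \<comment> \<open>Height 0 acts as a derivation, height 1 prepends a letter.\<close>
    proof (cases "ht I \<gamma> = 0")
      case True
      then show ?thesis using \<open>b \<in> root_words I \<delta>\<close> x bracket_height0_root_word by blast
    next
      case False
      then have "ht I \<gamma> = 1" using x(2) by simp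
      then show ?thesis using \<open>b \<in> root_words I \<delta>\<close> x root_words_bracket span_base by blast
    qed
    then show ?thesis
      using span_mono[of "root_words I (\<gamma> + \<delta>)" "T (\<gamma> + \<delta>)"] by (auto simp: T_def)
  next
    case False
    then have "b \<in> G \<delta>" "ht I \<delta> = 0" using that by (auto simp: T_def split: if_splits)
    then have "bracket x b \<in> T (\<gamma> + \<delta>)"
      using T_low[of "\<gamma> + \<delta>"] x bracket_G by (auto simp: ht_add)
    then show ?thesis by (rule span_base)
  qed
  have "bracket x b \<in> span (\<Union>\<delta>. T \<delta>)" if b: "b \<in> (\<Union>\<delta>. T \<delta>)" for b
  proof -
    obtain \<delta> where "b \<in> T \<delta>" using b by blast
    moreover have "span (T (\<gamma> + \<delta>)) \<subseteq> span (\<Union>\<delta>. T \<delta>)" by (rule span_mono) blast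
    ultimately show ?thesis using stable by blast
  qed
  then show "bracket x v \<in> span (\<Union>\<delta>. T \<delta>)"
    using v by (rule bracket_span[OF subspace_span])
qed

lemma span_root_words:
  assumes gen: "lie_generated (\<Union>i. G (simple_root i)) = UNIV" and "ht I \<beta> > 0"
  shows "span (root_words I \<beta>) = G \<beta>"
proof
  show "span (root_words I \<beta>) \<subseteq> G \<beta>"
    by (rule span_minimal[OF root_words_subset subspace_G])
  show "G \<beta> \<subseteq> span (root_words I \<beta>)"
  proof
    fix v assume "v \<in> G \<beta>"
    moreover have "root_words I \<delta> \<union> (if ht I \<delta> = 0 then G \<delta> else {}) \<subseteq> G \<delta>" for \<delta>
      using root_words_subset by simp
    ultimately have "v \<in> span (root_words I \<beta> \<union> (if ht I \<beta> = 0 then G \<beta> else {}))"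
      using homogeneous_span[where T = "\<lambda>\<delta>. root_words I \<delta> \<union> (if ht I \<delta> = 0 then G \<delta> else {})"]
        span_height0_root_words[OF gen, of I] by simp
    \<comment> \<open>The height-0 part is empty here because \<open>\<beta>\<close> has positive
      height.\<close>
    then show "v \<in> span (root_words I \<beta>)" using assms(2) by simp
  qed
qed

text \<open>Each letter contributes 1 to the additive height; this forces words of degree
  \<open>\<beta>\<close> to have \<open>n\<close> letters.\<close>

lemma letters_length: "letters I xs \<gamma>s \<Longrightarrow> ht I (sum_list \<gamma>s) = length xs"
  unfolding letters_def by (induction rule: list_all2_induct) (simp_all add: ht_add)

end

section \<open>From lists of letters and degrees to families indexed by
  \<open>{1..n}\<close>\<close>

theorem theorem3p1:
  fixes scale :: "'f::field \<Rightarrow> 'v::ab_group_add \<Rightarrow> 'v"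
    and bracket :: "'v \<Rightarrow> 'v \<Rightarrow> 'v"
    and G :: "('i \<Rightarrow>\<^sub>0 nat) \<Rightarrow> 'v set"
    and I :: "'i set"
    and \<beta> :: "'i \<Rightarrow>\<^sub>0 nat"
    and n :: nat
  assumes "graded_lie_algebra scale bracket G"
    and "\<And>i. G (simple_root i) \<noteq> {0}"
    and "lie_algebra.lie_generated scale bracket (\<Union>i. G (simple_root i)) = UNIV"
    and "I \<noteq> {}"
    and "\<beta> \<in> degrees G"
    and "ht I \<beta> > 0"
    and "n = ht I \<beta>"
  shows "module.span scale
      {lie_word bracket (map x [1..<n+1]) | x \<gamma>.
        (\<forall>j\<in>{1..n}. \<gamma> j \<in> degrees1 G I \<and> x j \<noteq> 0 \<and> x j \<in> G (\<gamma> j)) \<and>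
        (\<Sum>j=1..n. \<gamma> j) = \<beta>}
    = G \<beta>"
proof -
  interpret graded_lie_algebra scale bracket G by fact
  let ?W = "{lie_word bracket (map x [1..<n+1]) | x \<gamma>.
        (\<forall>j\<in>{1..n}. \<gamma> j \<in> degrees1 G I \<and> x j \<noteq> 0 \<and> x j \<in> G (\<gamma> j)) \<and>
        (\<Sum>j=1..n. \<gamma> j) = \<beta>}"
  have W_le: "?W \<subseteq> root_words I \<beta>"
  proof
    fix w assume "w \<in> ?W"
    then obtain x \<gamma> where w: "w = lie_word bracket (map x [1..<n+1])"
      and *: "\<forall>j\<in>{1..n}. \<gamma> j \<in> degrees1 G I \<and> x j \<noteq> 0 \<and> x j \<in> G (\<gamma> j)"
      and sum: "(\<Sum>j=1..n. \<gamma> j) = \<beta>"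
      by blast
    have "letters I (map x [1..<n+1]) (map \<gamma> [1..<n+1])"
      using * by (simp add: letters_def degrees1_def list_all2_map1 list_all2_map2 list_all2_same del: upt_Suc)
    \<comment> \<open>\<open>[1..<n+1]\<close> is distinct with set \<open>{1..n}\<close>, so the
      list sum is the indexed sum.\<close>
    moreover have "sum_list (map \<gamma> [1..<n+1]) = \<beta>"
      using sum_list_distinct_conv_sum_set[of "[1..<n+1]" \<gamma>] sum
      by (simp add: atLeastLessThanSuc_atLeastAtMost del: upt_Suc)
    moreover have "map x [1..<n+1] \<noteq> []"
      using assms(6,7) by simp
    ultimately show "w \<in> root_words I \<beta>"
      unfolding root_words_def w by blast
  qed
  \<comment> \<open>Words with a zero letter are 0, and adjoining 0 does not change a span.\<close>
  have "root_words I \<beta> \<subseteq> insert 0 ?W"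
  proof
    fix w assume "w \<in> root_words I \<beta>"
    then obtain xs \<gamma>s where w: "w = lie_word bracket xs" "letters I xs \<gamma>s" "sum_list \<gamma>s = \<beta>"
      unfolding root_words_def by blast
    have len: "length xs = n" "length \<gamma>s = n"
      using letters_length[OF w(2)] w assms(7) by (auto simp: letters_def dest: list_all2_lengthD)
    show "w \<in> insert 0 ?W"
    proof (cases "0 \<in> set xs")
      case True
      then show ?thesis using w lie_word_zero_letter by simp
    next
      case False
      \<comment> \<open>Letters are numbered from 1, list positions from 0.\<close>
      define x where "x j = xs ! (j - 1)" for j
      define \<gamma> where "\<gamma> j = \<gamma>s ! (j - 1)" for j
      have "map x [1..<n+1] = xs"
        using len by (intro nth_equalityI) (simp_all add: x_def del: upt_Suc)
      moreover have "map \<gamma> [1..<n+1] = \<gamma>s"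
        using len by (intro nth_equalityI) (simp_all add: \<gamma>_def del: upt_Suc)
      then have "(\<Sum>j=1..n. \<gamma> j) = \<beta>"
        using w(3) sum_list_distinct_conv_sum_set[of "[1..<n+1]" \<gamma>]
        by (simp add: atLeastLessThanSuc_atLeastAtMost del: upt_Suc)
      moreover have "\<gamma> j \<in> degrees1 G I \<and> x j \<noteq> 0 \<and> x j \<in> G (\<gamma> j)" if "j \<in> {1..n}" for j
      proof -
        have j: "j - 1 < length xs" using that len by auto
        then have "x j \<in> G (\<gamma> j)" "ht I (\<gamma> j) = 1"
          using w(2) by (auto simp: letters_def x_def \<gamma>_def list_all2_conv_all_nth)
        moreover have "x j \<noteq> 0"
          using j False unfolding x_def by (metis nth_mem)
        \<comment> \<open>The non-zero \<open>x j\<close> witnesses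
          \<open>G (\<gamma> j) \<noteq> {0}\<close>.\<close>
        ultimately show ?thesis by (auto simp: degrees1_def degrees_def)
      qed
      ultimately show ?thesis using w(1) by blast
    qed
  qed
  from span_mono[OF W_le] span_mono[OF this] have "span ?W = span (root_words I \<beta>)"
    unfolding span_insert_0 by (rule subset_antisym)
  then show ?thesis
    using span_root_words[OF assms(3,6)] by simp
qed

end
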